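(* Let $\mathcal{X}$ be a set, $x_1,\ldots,x_n\in\mathcal{X}$ fixed design points, $\mathcal{M}$ a (nonempty) family of functions $m:\mathcal{X}\to\mathbb{R}$ such that $m+c\in\mathcal{M}$ for arbitrary $m\in\mathcal{M}$ and $c\in\mathbb{R}$, and let $\boldsymbol{Y}=(Y_i)_{i=1}^n\in\mathbb{R}^n$ be the vector of observations. Suppose that the set $\mathcal{M}(\boldsymbol{x}):=\{(m(x_i))_{i=1}^n:m\in\mathcal{M}\}\subset\mathbb{R}^n$ is closed and does not contain $\boldsymbol{Y}$. Then there exists a maximizer $(\hat\phi,\hat m)$ of $$\hat\Lambda(\phi,m):=\frac1n\sum_{i=1}^n\phi\bigl(Y_i-m(x_i)\bigr)-\int e^{\phi(x)}\,dx+1$$ over all $(\phi,m)\in\Phi\times\mathcal{M}$.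
   Context: $\Phi=\Phi(1)$ is the family of concave functions $\phi:\mathbb{R}\to[-\infty,\infty)$ which are upper semicontinuous and coercive ($\phi(x)\to-\infty$ as $|x|\to\infty$); $e^{-\infty}=0$. *)

theory Defs
  imports "HOL-Analysis.Analysis"
begin

text \<open>The exponential on \<open>[-\<infinity>, \<infinity>]\<close>, with the convention \<open>e\<^sup>-\<^sup>\<infinity> = 0\<close>.\<close>

definition exp_ext :: "ereal \<Rightarrow> ennreal" where
  "exp_ext y = (case y of ereal r \<Rightarrow> ennreal (exp r) | PInfty \<Rightarrow> \<infinity> | MInfty \<Rightarrow> 0)"

text \<open>Concavity is only used for functions that avoid \<open>\<infinity>\<close>, so the right-hand side never
  has the form \<open>\<infinity> - \<infinity>\<close>. Restricting to \<open>0 < t < 1\<close> avoids the product \<open>0 * (-\<infinity>)\<close> and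
  loses nothing, the cases \<open>t = 0\<close> and \<open>t = 1\<close> being trivial.\<close>

definition concave_ext :: "(real \<Rightarrow> ereal) \<Rightarrow> bool" where
  "concave_ext \<phi> \<longleftrightarrow>
     (\<forall>x y t. 0 < t \<and> t < 1 \<longrightarrow>
        \<phi> ((1 - t) * x + t * y) \<ge> ereal (1 - t) * \<phi> x + ereal t * \<phi> y)"

definition usc :: "(real \<Rightarrow> ereal) \<Rightarrow> bool" where
  "usc \<phi> \<longleftrightarrow> (\<forall>x. Limsup (at x) \<phi> \<le> \<phi> x)"

definition coercive :: "(real \<Rightarrow> ereal) \<Rightarrow> bool" where
  "coercive \<phi> \<longleftrightarrow> (\<phi> \<longlongrightarrow> -\<infinity>) at_infinity"

text \<open>The family \<open>\<Phi> = \<Phi>(1)\<close>. The constant function \<open>-\<infinity>\<close> is a member.\<close>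

definition Phi :: "(real \<Rightarrow> ereal) set" where
  "Phi = {\<phi>. (\<forall>x. \<phi> x \<noteq> \<infinity>) \<and> concave_ext \<phi> \<and> usc \<phi> \<and> coercive \<phi>}"

text \<open>The sample size \<open>n\<close> is \<open>CARD('n)\<close>. The criterion takes values in \<open>[-\<infinity>, \<infinity>)\<close> for
  \<open>\<phi> \<in> Phi\<close>: no summand is \<open>\<infinity>\<close> and the integral is nonnegative.\<close>

definition Lambda_hat ::
    "('n::finite \<Rightarrow> 'x) \<Rightarrow> real ^ 'n \<Rightarrow> (real \<Rightarrow> ereal) \<Rightarrow> ('x \<Rightarrow> real) \<Rightarrow> ereal" where
  "Lambda_hat x Y \<phi> m =
     ereal (1 / real CARD('n)) * (\<Sum>i\<in>UNIV. \<phi> (Y $ i - m (x i)))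
     - enn2ereal (\<integral>\<^sup>+ z. exp_ext (\<phi> z) \<partial>lborel) + 1"

definition fitted_vectors :: "('n::finite \<Rightarrow> 'x) \<Rightarrow> ('x \<Rightarrow> real) set \<Rightarrow> (real ^ 'n) set" where
  "fitted_vectors x M = {\<chi> i. m (x i) | m. m \<in> M}"

end

theory Submission
  imports Defs
begin

text \<open>
  Write \<open>r = Y - m(x)\<close> for the residual vector. If \<open>\<phi>\<close> is finite at all \<open>r $ i\<close>, only the values
  \<open>y $ i = \<phi> (r $ i)\<close> enter the first term of the criterion, so for given \<open>r\<close> and \<open>y\<close> the best
  \<open>\<phi>\<close> has the smallest integral: it is the least concave majorant of the points
  \<open>(r $ i, y $ i)\<close>. This \<^emph>\<open>upper hull\<close> is the infimum of the affine functions above the points.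
  As such an infimum it is concave and upper semicontinuous, and it is \<open>-\<infinity>\<close> outside the convex
  hull of the residuals, hence it lies in \<open>Phi\<close>. The infinite-dimensional problem becomes the
  maximization of the finite-dimensional \<^emph>\<open>profile\<close>, mean of \<open>y\<close> minus mass below the hull.

  The link between the hull and other concave functions is elementary
  (\<open>upper_hull_off_knots\<close>): at a point that is no residual the hull is either \<open>-\<infinity>\<close> or the value
  of a chord between a residual on the left and a residual on the right. Since the residuals form
  a null set, this gives both facts that the integral needs. The hull lies almost everywhere below
  each concave function through the points (\<open>upper_hull_minimal\<close>), and, chords being continuous
  in their end points, Fatou's lemma makes the mass lower semicontinuous
  (\<open>hull_mass_limit_bound\<close>).

  It remains to confine a maximizing sequence. Adding a constant to \<open>m\<close> translates the hull and
  leaves the profile unchanged, so one residual may be normalized to \<open>0\<close>. The normalized residual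
  vectors form a closed set that does not contain \<open>0\<close>, because \<open>Y\<close> is not fitted exactly; hence
  their norms are bounded below by some \<open>\<delta> > 0\<close>. Let \<open>u\<close> be the largest \<open>y $ i\<close> and \<open>D\<close> the
  difference between the largest and the smallest. Near the residual where \<open>u\<close> is attained the
  hull stays above \<open>u - 1\<close> on an interval whose length is of order \<open>norm r / (1 + D)\<close>, so with
  \<open>n\<close> observations the profile is at most
  \<open>u - D / n - K * norm r * exp u / (1 + D)\<close> for a constant \<open>K > 0\<close>. For \<open>norm r \<ge> \<delta>\<close> this tends
  to \<open>-\<infinity>\<close> whenever \<open>r\<close> or \<open>y\<close> becomes unbounded (\<open>profile_bound_coercive\<close>). Without the
  lower bound \<open>\<delta>\<close> the mass could be concentrated at a single point at no cost, and the criterion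
  would be unbounded. Compactness of bounded closed sets and semicontinuity then yield a maximizer.
\<close>

section \<open>The upper hull of finitely many points\<close>

definition affine_majorants :: "real ^ 'n \<Rightarrow> real ^ 'n \<Rightarrow> (real \<times> real) set" where
  "affine_majorants r y = {(a, b). \<forall>i. y $ i \<le> a + b * r $ i}"

definition upper_hull :: "real ^ 'n::finite \<Rightarrow> real ^ 'n \<Rightarrow> real \<Rightarrow> ereal" where
  "upper_hull r y z = (INF (a, b) \<in> affine_majorants r y. ereal (a + b * z))"

definition chord :: "real ^ 'n::finite \<Rightarrow> real ^ 'n \<Rightarrow> 'n \<Rightarrow> 'n \<Rightarrow> real \<Rightarrow> real" where
  "chord r y i j z = ((r $ j - z) * y $ i + (z - r $ i) * y $ j) / (r $ j - r $ i)"

lemma upper_hull_le: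
  assumes "\<And>i. y $ i \<le> a + b * r $ i"
  shows "upper_hull r y z \<le> ereal (a + b * z)"
  unfolding upper_hull_def
  by (rule INF_lower2[where i = "(a, b)"]) (use assms in \<open>auto simp: affine_majorants_def\<close>)

lemma upper_hull_ge:
  assumes "\<And>a b. (\<And>i. y $ i \<le> a + b * r $ i) \<Longrightarrow> v \<le> ereal (a + b * z)"
  shows "v \<le> upper_hull r y z"
  unfolding upper_hull_def
  by (rule INF_greatest) (use assms in \<open>auto simp: affine_majorants_def\<close>)

lemma upper_hull_le_Max: "upper_hull r y z \<le> ereal (Max (range (($) y)))"
  using upper_hull_le[of y "Max (range (($) y))" 0 r z] by simp

lemma upper_hull_at_knot: "ereal (y $ i) \<le> upper_hull r y (r $ i)"
  by (rule upper_hull_ge) simp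

lemma chord_le_upper_hull:
  assumes "r $ i < z" "z < r $ j"
  shows "ereal (chord r y i j z) \<le> upper_hull r y z"
proof (rule upper_hull_ge)
  fix a b assume maj: "\<And>k. y $ k \<le> a + b * r $ k"
  have "(r $ j - z) * y $ i + (z - r $ i) * y $ j
      \<le> (r $ j - z) * (a + b * r $ i) + (z - r $ i) * (a + b * r $ j)"
    using assms maj by (intro add_mono mult_left_mono) auto
  also have "\<dots> = (a + b * z) * (r $ j - r $ i)" by (simp add: algebra_simps)
  finally show "ereal (chord r y i j z) \<le> ereal (a + b * z)"
    using assms by (simp add: chord_def pos_divide_le_eq)
qed

text \<open>A line through \<open>(z, v)\<close> lies above a point to the left of \<open>z\<close> iff its slope is at most a certain
  value, and above a point to the right iff its slope is at least a certain value. The chord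
  condition says exactly that each lower bound is at most each upper bound, so an admissible slope
  exists. If there are no points on the right, the least of the upper bounds will do.\<close>

lemma affine_majorant_through:
  fixes r y :: "real ^ 'n::finite"
  assumes off: "\<And>i. r $ i \<noteq> z"
    and chords: "\<And>i j. r $ i < z \<Longrightarrow> z < r $ j \<Longrightarrow> chord r y i j z \<le> v"
  obtains b where "\<And>i. y $ i \<le> v + b * (r $ i - z)"
proof -
  define L where "L = {i. r $ i < z}"
  define R where "R = {j. z < r $ j}"
  define s where "s i = (y $ i - v) / (r $ i - z)" for i
  have fin: "finite L" "finite R" by auto
  have LR: "i \<in> L \<or> i \<in> R" for i using off[of i] by (auto simp: L_def R_def)
  have sL: "y $ i \<le> v + b * (r $ i - z) \<longleftrightarrow> b \<le> s i" if "i \<in> L" for i b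
    using that by (auto simp: L_def s_def neg_le_divide_eq)
  have sR: "y $ i \<le> v + b * (r $ i - z) \<longleftrightarrow> s i \<le> b" if "i \<in> R" for i b
    using that by (auto simp: R_def s_def pos_divide_le_eq)
  have sRL: "s j \<le> s i" if "i \<in> L" "j \<in> R" for i j
  proof -
    have p: "r $ j - z > 0" "z - r $ i > 0" using that by (auto simp: L_def R_def)
    have "(r $ j - z) * y $ i + (z - r $ i) * y $ j \<le> v * (r $ j - r $ i)"
      using chords[of i j] that by (auto simp: L_def R_def chord_def pos_divide_le_eq)
    then have "(y $ j - v) * (z - r $ i) \<le> (v - y $ i) * (r $ j - z)"
      by (simp add: algebra_simps)
    then have "(y $ j - v) / (r $ j - z) \<le> (v - y $ i) / (z - r $ i)"
      using p by (simp add: divide_simps)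
    also have "\<dots> = s i" unfolding s_def by (metis minus_diff_eq minus_divide_divide)
    finally show ?thesis by (simp add: s_def)
  qed
  show thesis
  proof (cases "R = {}")
    case True
    then have "y $ i \<le> v + Min (s ` L) * (r $ i - z)" for i
      using LR[of i] fin by (simp add: sL)
    then show thesis by (rule that)
  next
    case False
    have "y $ i \<le> v + Max (s ` R) * (r $ i - z)" for i
    proof (cases "i \<in> L")
      case True
      then show ?thesis using False fin sRL by (simp add: sL)
    next
      case False
      then have "i \<in> R" using LR by auto
      then show ?thesis using fin by (simp add: sR)
    qed
    then show thesis by (rule that)
  qed
qed

text \<open>Every value \<open>v\<close> above all chords at \<open>z\<close> is attained by an affine majorant, so the hull is at
  most the largest chord, and trivially at least that. If no chord passes over \<open>z\<close>, then every
  real \<open>v\<close> is admissible. The points with \<open>r $ i = z\<close> are excluded because there the slope bounds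
  above degenerate; they are finitely many and do not affect integrals.\<close>

lemma upper_hull_off_knots:
  fixes r y :: "real ^ 'n::finite"
  assumes off: "\<And>i. r $ i \<noteq> z"
  obtains (outside) "upper_hull r y z = -\<infinity>"
  | (inside) i j where "r $ i < z" "z < r $ j" "upper_hull r y z = ereal (chord r y i j z)"
proof -
  define P where "P = {(i, j). r $ i < z \<and> z < r $ j}"
  have le: "upper_hull r y z \<le> ereal v" if v: "\<And>i j. (i, j) \<in> P \<Longrightarrow> chord r y i j z \<le> v" for v
  proof -
    obtain b where "\<And>i. y $ i \<le> v + b * (r $ i - z)"
      using affine_majorant_through[of r z y v, OF off v] by (auto simp: P_def)
    then have "\<And>i. y $ i \<le> (v - b * z) + b * r $ i" by (simp add: algebra_simps)
    from upper_hull_le[OF this, of z] show ?thesis by simp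
  qed
  show thesis
  proof (cases "P = {}")
    case True
    then have "upper_hull r y z \<le> ereal v" for v using le by simp
    then have "upper_hull r y z = -\<infinity>" by (rule ereal_bot)
    then show thesis by (rule outside)
  next
    case False
    define V where "V = (\<lambda>(i, j). chord r y i j z) ` P"
    have fin: "finite V" "V \<noteq> {}" using False by (auto simp: V_def)
    from Max_in[OF fin] obtain i j where ij: "(i, j) \<in> P" "Max V = chord r y i j z"
      by (auto simp: V_def)
    have "chord r y k l z \<le> Max V" if "(k, l) \<in> P" for k l
      by (rule Max_ge[OF fin(1)]) (use that in \<open>auto simp: V_def\<close>)
    from le[OF this] have "upper_hull r y z \<le> ereal (chord r y i j z)" by (simp add: ij)
    moreover have "ereal (chord r y i j z) \<le> upper_hull r y z"
      using ij by (intro chord_le_upper_hull) (auto simp: P_def)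
    ultimately show thesis using ij by (intro inside) (auto simp: P_def)
  qed
qed

lemma upper_hull_outside:
  fixes r y :: "real ^ 'n::finite"
  assumes "norm r < \<bar>z\<bar>"
  shows "upper_hull r y z = -\<infinity>"
proof -
  have b: "\<bar>r $ i\<bar> < \<bar>z\<bar>" for i using component_le_norm_cart[of r i] assms by linarith
  then have "r $ i \<noteq> z" for i by (metis less_irrefl)
  then show ?thesis
  proof (cases rule: upper_hull_off_knots[of r z y])
    case (inside i j)
    then show ?thesis using b[of i] b[of j] by linarith
  qed auto
qed

lemma concave_ext_upper_hull: "concave_ext (upper_hull r y)"
  unfolding concave_ext_def
proof (intro allI impI upper_hull_ge)
  fix u w t a b :: real
  assume t: "0 < t \<and> t < 1" and maj: "\<And>i. y $ i \<le> a + b * r $ i"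
  have "ereal (1 - t) * upper_hull r y u + ereal t * upper_hull r y w
      \<le> ereal (1 - t) * ereal (a + b * u) + ereal t * ereal (a + b * w)"
    using t maj by (intro add_mono ereal_mult_left_mono upper_hull_le) auto
  also have "\<dots> = ereal (a + b * ((1 - t) * u + t * w))" by (simp add: algebra_simps)
  finally show "ereal (1 - t) * upper_hull r y u + ereal t * upper_hull r y w
      \<le> ereal (a + b * ((1 - t) * u + t * w))" .
qed

lemma usc_upper_hull: "usc (upper_hull r y)"
  unfolding usc_def
proof (intro allI upper_hull_ge)
  fix z a b assume maj: "\<And>i. y $ i \<le> a + b * r $ i"
  have "Limsup (at z) (upper_hull r y) \<le> Limsup (at z) (\<lambda>w. ereal (a + b * w))"
    by (intro Limsup_mono always_eventually allI upper_hull_le maj)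
  also have "((\<lambda>w. ereal (a + b * w)) \<longlongrightarrow> ereal (a + b * z)) (at z)"
    by (intro tendsto_intros)
  then have "Limsup (at z) (\<lambda>w. ereal (a + b * w)) = ereal (a + b * z)"
    by (intro lim_imp_Limsup) auto
  finally show "Limsup (at z) (upper_hull r y) \<le> ereal (a + b * z)" .
qed

lemma coercive_upper_hull: "coercive (upper_hull r y)"
proof -
  have "\<forall>\<^sub>F z in at_infinity. upper_hull r y z = -\<infinity>"
    unfolding eventually_at_infinity
    by (rule exI[where x = "norm r + 1"]) (auto intro!: upper_hull_outside)
  then show ?thesis unfolding coercive_def by (rule tendsto_eventually)
qed

lemma upper_hull_in_Phi: "upper_hull r y \<in> Phi"
proof -
  have "upper_hull r y z \<noteq> \<infinity>" for z using upper_hull_le_Max[of r y z] by auto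
  then show ?thesis
    by (simp add: Phi_def concave_ext_upper_hull usc_upper_hull coercive_upper_hull)
qed

text \<open>The chord that gives the value of the hull joins two points on the graph of \<open>\<phi>\<close>.\<close>

lemma upper_hull_minimal:
  fixes r y :: "real ^ 'n::finite"
  assumes "concave_ext \<phi>" and knots: "\<And>i. \<phi> (r $ i) = ereal (y $ i)"
    and off: "\<And>i. r $ i \<noteq> z"
  shows "upper_hull r y z \<le> \<phi> z"
  using off
proof (cases rule: upper_hull_off_knots[of r z y])
  case (inside i j)
  define t where "t = (z - r $ i) / (r $ j - r $ i)"
  have t: "0 < t" "t < 1" using inside by (auto simp: t_def)
  have z: "(1 - t) * r $ i + t * r $ j = z"
    using inside by (simp add: t_def divide_simps) (simp add: algebra_simps)
  have "chord r y i j z = (1 - t) * y $ i + t * y $ j"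
    using inside by (simp add: t_def chord_def divide_simps)
  then have "upper_hull r y z = ereal (1 - t) * \<phi> (r $ i) + ereal t * \<phi> (r $ j)"
    using inside knots by simp
  also have "\<dots> \<le> \<phi> ((1 - t) * r $ i + t * r $ j)"
    using assms(1) t unfolding concave_ext_def by blast
  finally show ?thesis by (simp add: z)
qed simp

lemma upper_hull_shift:
  fixes r y :: "real ^ 'n::finite"
  shows "upper_hull (\<chi> i. r $ i + c) y (z + c) = upper_hull r y z"
proof (rule antisym)
  show "upper_hull (\<chi> i. r $ i + c) y (z + c) \<le> upper_hull r y z"
  proof (rule upper_hull_ge)
    fix a b assume "\<And>i. y $ i \<le> a + b * r $ i"
    then have "upper_hull (\<chi> i. r $ i + c) y (z + c) \<le> ereal ((a - b * c) + b * (z + c))"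
      by (intro upper_hull_le) (simp add: algebra_simps)
    then show "upper_hull (\<chi> i. r $ i + c) y (z + c) \<le> ereal (a + b * z)"
      by (simp add: algebra_simps)
  qed
  show "upper_hull r y z \<le> upper_hull (\<chi> i. r $ i + c) y (z + c)"
  proof (rule upper_hull_ge)
    fix a b assume "\<And>i. y $ i \<le> a + b * (\<chi> i. r $ i + c) $ i"
    then have "upper_hull r y z \<le> ereal ((a + b * c) + b * z)"
      by (intro upper_hull_le) (simp add: algebra_simps)
    then show "upper_hull r y z \<le> ereal (a + b * (z + c))"
      by (simp add: algebra_simps)
  qed
qed

section \<open>The mass below the upper hull\<close>

lemma exp_ext_ereal [simp]: "exp_ext (ereal v) = ennreal (exp v)"
  and exp_ext_MInf [simp]: "exp_ext (-\<infinity>) = 0"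
  by (auto simp: exp_ext_def)

lemma exp_ext_mono: "u \<le> v \<Longrightarrow> exp_ext u \<le> exp_ext v"
  by (cases u; cases v) (auto simp: exp_ext_def)

lemma borel_measurable_exp_ext [measurable]: "exp_ext \<in> borel_measurable borel"
proof -
  have "exp_ext = (\<lambda>v. if v = \<infinity> then \<infinity> else if v = -\<infinity> then 0
      else ennreal (exp (real_of_ereal v)))"
    by (rule ext) (auto simp: exp_ext_def split: ereal.split)
  also have "\<dots> \<in> borel_measurable borel" by measurable
  finally show ?thesis .
qed

lemma borel_measurable_upper_hull [measurable]: "upper_hull r y \<in> borel_measurable borel"
proof (rule borel_measurableI_less)
  fix v
  have "{z. upper_hull r y z < v} =
      (\<Union>(a, b) \<in> affine_majorants r y. {z. ereal (a + b * z) < v})"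
    by (force simp: upper_hull_def INF_less_iff)
  moreover have "open {z. ereal (a + b * z) < v}" for a b :: real
    by (intro open_Collect_less continuous_intros)
  ultimately have "open {z. upper_hull r y z < v}" by auto
  then show "{z \<in> space borel. upper_hull r y z < v} \<in> sets borel" by simp
qed

text \<open>This turns statements about the hull away from the residuals into statements about integrals.\<close>

lemma AE_off_knots:
  fixes r :: "real ^ 'n::finite"
  shows "AE z in lborel. \<forall>i. r $ i \<noteq> z"
proof -
  have "range (($) r) \<in> null_sets lborel" by (intro finite_imp_null_set_lborel) simp
  from AE_not_in[OF this] show ?thesis by eventually_elim auto
qed

text \<open>A real number instead of an extended one, so that masses can be subtracted; the integral is
  always finite, see \<open>ennreal_hull_mass\<close>.\<close>

definition hull_mass :: "real ^ 'n::finite \<Rightarrow> real ^ 'n \<Rightarrow> real" where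
  "hull_mass r y = enn2real (\<integral>\<^sup>+ z. exp_ext (upper_hull r y z) \<partial>lborel)"

text \<open>The hull is bounded above by the largest \<open>y $ i\<close> and is \<open>-\<infinity>\<close> outside a bounded interval.\<close>

lemma ennreal_hull_mass:
  "ennreal (hull_mass r y) = (\<integral>\<^sup>+ z. exp_ext (upper_hull r y z) \<partial>lborel)"
proof -
  define c where "c = ennreal (exp (Max (range (($) y))))"
  have "exp_ext (upper_hull r y z) \<le> c * indicator {- norm r .. norm r} z" for z
  proof (cases "norm r < \<bar>z\<bar>")
    case True
    then show ?thesis by (simp add: upper_hull_outside)
  next
    case False
    then show ?thesis using exp_ext_mono[OF upper_hull_le_Max[of r y z]]
      by (auto simp: c_def indicator_def)
  qed
  then have "(\<integral>\<^sup>+ z. exp_ext (upper_hull r y z) \<partial>lborel)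
      \<le> (\<integral>\<^sup>+ z. c * indicator {- norm r .. norm r} z \<partial>lborel)"
    by (intro nn_integral_mono)
  also have "\<dots> = c * ennreal (2 * norm r)" by (subst nn_integral_cmult_indicator) auto
  also have "\<dots> < \<infinity>" by (simp add: c_def ennreal_mult_less_top)
  finally show ?thesis unfolding hull_mass_def by (intro ennreal_enn2real) simp
qed

lemma hull_mass_nonneg: "0 \<le> hull_mass r y"
  by (simp add: hull_mass_def)

lemma hull_mass_shift: "hull_mass (\<chi> i. r $ i + c) y = hull_mass r y"
proof -
  have "(\<integral>\<^sup>+ z. exp_ext (upper_hull (\<chi> i. r $ i + c) y z) \<partial>lborel)
      = (\<integral>\<^sup>+ z. exp_ext (upper_hull (\<chi> i. r $ i + c) y (z + c)) \<partial>lborel)"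
    by (subst nn_integral_real_affine[where c = 1 and t = c]) (simp_all add: add.commute)
  then show ?thesis by (simp add: hull_mass_def upper_hull_shift)
qed

text \<open>The segment from point \<open>i\<close> to point \<open>j\<close> lies below the hull and descends by at most \<open>D\<close>, so on
  the first fraction \<open>1 / (1 + D)\<close> of the way it descends by at most \<open>1\<close>. The fraction is not \<open>1 / D\<close>,
  since \<open>D\<close> may vanish.\<close>

lemma hull_mass_lower_bound:
  fixes r y :: "real ^ 'n::finite"
  assumes "0 \<le> D" "y $ i - y $ j \<le> D"
  shows "\<bar>r $ j - r $ i\<bar> * exp (y $ i - 1) / (1 + D) \<le> hull_mass r y"
proof -
  define w where "w = (r $ j - r $ i) / (1 + D)"
  define S where "S = {min (r $ i) (r $ i + w) .. max (r $ i) (r $ i + w)}"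
  have high: "ereal (y $ i - 1) \<le> upper_hull r y z" if z: "z \<in> S" for z
  proof -
    obtain l where l: "0 \<le> l" "l \<le> 1" "z = r $ i + l * w"
    proof (cases "w = 0")
      case True
      then show thesis using z that[of 0] by (simp add: S_def)
    next
      case False
      show thesis
      proof (rule that[of "(z - r $ i) / w"])
        show "0 \<le> (z - r $ i) / w" "(z - r $ i) / w \<le> 1" "z = r $ i + (z - r $ i) / w * w"
          using z False by (auto simp: S_def divide_simps min_def max_def split: if_splits)
      qed
    qed
    define t where "t = l / (1 + D)"
    have t: "0 \<le> t" "t * D \<le> 1" "t \<le> 1"
      using l assms mult_mono[of l 1 D D] by (auto simp: t_def divide_simps)
    have zt: "z = r $ i + t * (r $ j - r $ i)" using l by (simp add: t_def w_def)
    show ?thesis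
    proof (rule upper_hull_ge)
      fix a b assume maj: "\<And>k. y $ k \<le> a + b * r $ k"
      have "y $ i - 1 \<le> y $ i - t * D" using t by simp
      also have "\<dots> \<le> y $ i - t * (y $ i - y $ j)" using t assms by (simp add: mult_left_mono)
      also have "\<dots> = (1 - t) * y $ i + t * y $ j" by (simp add: algebra_simps)
      also have "\<dots> \<le> (1 - t) * (a + b * r $ i) + t * (a + b * r $ j)"
        using t maj by (intro add_mono mult_left_mono) auto
      also have "\<dots> = a + b * z" by (simp add: zt algebra_simps)
      finally show "ereal (y $ i - 1) \<le> ereal (a + b * z)" by simp
    qed
  qed
  have "ennreal (exp (y $ i - 1) * \<bar>w\<bar>) = ennreal (exp (y $ i - 1)) * emeasure lborel S"
    by (simp add: S_def ennreal_mult' min_def max_def)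
  also have "\<dots> = (\<integral>\<^sup>+ z. ennreal (exp (y $ i - 1)) * indicator S z \<partial>lborel)"
    by (subst nn_integral_cmult_indicator) (auto simp: S_def)
  also have "\<dots> \<le> (\<integral>\<^sup>+ z. exp_ext (upper_hull r y z) \<partial>lborel)"
  proof (rule nn_integral_mono)
    fix z show "ennreal (exp (y $ i - 1)) * indicator S z \<le> exp_ext (upper_hull r y z)"
      using exp_ext_mono[OF high[of z]] by (cases "z \<in> S") auto
  qed
  finally have "exp (y $ i - 1) * \<bar>w\<bar> \<le> hull_mass r y"
    by (simp add: ennreal_hull_mass[symmetric] hull_mass_nonneg)
  then show ?thesis using assms by (simp add: w_def abs_divide mult.commute)
qed

text \<open>A chord over a point \<open>z\<close> strictly between two residuals persists under small perturbations and
  its value at \<open>z\<close> varies continuously. Hence the hulls are in the limit at least as large as the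
  hull of the limit, at almost every \<open>z\<close>, and Fatou's lemma applies.\<close>

lemma hull_mass_limit_bound:
  fixes R Z :: "nat \<Rightarrow> real ^ 'n::finite"
  assumes R: "R \<longlonglongrightarrow> r" and Z: "Z \<longlonglongrightarrow> y"
    and mass: "(\<lambda>k. hull_mass (R k) (Z k)) \<longlonglongrightarrow> c"
  shows "hull_mass r y \<le> c"
proof -
  have Ri: "(\<lambda>k. R k $ i) \<longlonglongrightarrow> r $ i" and Zi: "(\<lambda>k. Z k $ i) \<longlonglongrightarrow> y $ i" for i
    using R Z by (auto intro: tendsto_vec_nth)
  have c: "0 \<le> c" by (rule LIMSEQ_le_const[OF mass]) (auto intro: hull_mass_nonneg)
  have ptw: "exp_ext (upper_hull r y z) \<le> liminf (\<lambda>k. exp_ext (upper_hull (R k) (Z k) z))"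
    if off: "\<And>i. r $ i \<noteq> z" for z
    using off
  proof (cases rule: upper_hull_off_knots[of r z y])
    case (inside i j)
    have lim: "(\<lambda>k. ennreal (exp (chord (R k) (Z k) i j z)))
        \<longlonglongrightarrow> ennreal (exp (chord r y i j z))"
      unfolding chord_def using inside by (intro tendsto_intros Ri Zi tendsto_ennrealI) auto
    have "\<forall>\<^sub>F k in sequentially. R k $ i < z \<and> z < R k $ j"
      using inside by (intro eventually_conj order_tendstoD[OF Ri])
    then have ev: "\<forall>\<^sub>F k in sequentially. ennreal (exp (chord (R k) (Z k) i j z))
        \<le> exp_ext (upper_hull (R k) (Z k) z)"
    proof eventually_elim
      case (elim k)
      from exp_ext_mono[OF chord_le_upper_hull] elim show ?case by fastforce
    qed
    have "exp_ext (upper_hull r y z) = liminf (\<lambda>k. ennreal (exp (chord (R k) (Z k) i j z)))"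
      using lim_imp_Liminf[OF _ lim] inside by simp
    also have "\<dots> \<le> liminf (\<lambda>k. exp_ext (upper_hull (R k) (Z k) z))"
      by (rule Liminf_mono[OF ev])
    finally show ?thesis .
  qed simp
  have "ennreal (hull_mass r y) = (\<integral>\<^sup>+ z. exp_ext (upper_hull r y z) \<partial>lborel)"
    by (rule ennreal_hull_mass)
  also have "\<dots> \<le> (\<integral>\<^sup>+ z. liminf (\<lambda>k. exp_ext (upper_hull (R k) (Z k) z)) \<partial>lborel)"
    using AE_off_knots[of r] by (intro nn_integral_mono_AE) (auto intro: ptw)
  also have "\<dots> \<le> liminf (\<lambda>k. \<integral>\<^sup>+ z. exp_ext (upper_hull (R k) (Z k) z) \<partial>lborel)"
    by (intro nn_integral_liminf) measurable
  also have "\<dots> = liminf (\<lambda>k. ennreal (hull_mass (R k) (Z k)))"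
    by (simp add: ennreal_hull_mass)
  also have "\<dots> = ennreal c"
    by (intro lim_imp_Liminf tendsto_ennrealI mass) simp
  finally show ?thesis using c by simp
qed


section \<open>Coercivity of the profile criterion\<close>

text \<open>Up to the constant \<open>1\<close>, this is the maximum of the criterion over all \<open>\<phi>\<close> in \<open>Phi\<close> with values
  \<open>y $ i\<close> at the residuals \<open>r $ i\<close>, if there are such \<open>\<phi>\<close>. For other \<open>y\<close> the hull exceeds some
  \<open>y $ i\<close>, and the profile only underestimates the criterion at the hull. Both statements have the
  right direction for the maximization, so that \<open>y\<close> may range over the whole space.\<close>

definition profile :: "real ^ 'n::finite \<Rightarrow> real ^ 'n \<Rightarrow> real" where
  "profile r y = (\<Sum>i\<in>UNIV. y $ i) / real CARD('n) - hull_mass r y"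

lemma profile_shift: "profile (\<chi> i. r $ i + c) y = profile r y"
  by (simp add: profile_def hull_mass_shift)

text \<open>If \<open>y\<close> is largest at \<open>p\<close> and \<open>f\<close> is the index of the residual farthest from \<open>r $ p\<close>, then every
  \<open>\<bar>r $ k\<bar> = \<bar>r $ k - r $ e\<bar>\<close> is at most twice that distance, whence the distance is at least
  \<open>norm r / (2 n)\<close>. The lower bound on the mass is used between \<open>p\<close> and \<open>f\<close>.\<close>

lemma profile_upper_bound:
  fixes r y :: "real ^ 'n::finite"
  assumes "r $ e = 0"
  obtains p q where "\<And>k. y $ q \<le> y $ k" "\<And>k. y $ k \<le> y $ p"
    "profile r y \<le> y $ p - (y $ p - y $ q) / real CARD('n)
       - (norm r / (2 * real CARD('n) * exp 1)) * exp (y $ p) / (1 + (y $ p - y $ q))"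
proof -
  define n where "n = real CARD('n)"
  have n: "n > 0" by (simp add: n_def)
  have ex_max: "\<exists>i. \<forall>k. f k \<le> f i" for f :: "'n \<Rightarrow> real"
    using Max_in[of "range f"] Max_ge[of "range f"] by fastforce
  obtain p where p: "\<And>k. y $ k \<le> y $ p" using ex_max[of "($) y"] by auto
  obtain q where q: "\<And>k. y $ q \<le> y $ k" using ex_max[of "\<lambda>k. - y $ k"] by auto
  obtain f where f: "\<And>k. \<bar>r $ k - r $ p\<bar> \<le> \<bar>r $ f - r $ p\<bar>"
    using ex_max[of "\<lambda>k. \<bar>r $ k - r $ p\<bar>"] by auto
  define D where "D = y $ p - y $ q"
  have D: "0 \<le> D" using p[of q] by (simp add: D_def)
  have "norm r \<le> (\<Sum>k\<in>UNIV. \<bar>r $ k\<bar>)" by (rule norm_le_l1_cart)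
  also have "\<dots> \<le> (\<Sum>k\<in>(UNIV :: 'n set). 2 * \<bar>r $ f - r $ p\<bar>)"
  proof (rule sum_mono)
    fix k
    have "\<bar>r $ k\<bar> = \<bar>(r $ k - r $ p) - (r $ e - r $ p)\<bar>" using assms by simp
    also have "\<dots> \<le> \<bar>r $ k - r $ p\<bar> + \<bar>r $ e - r $ p\<bar>" by (rule abs_triangle_ineq4)
    finally show "\<bar>r $ k\<bar> \<le> 2 * \<bar>r $ f - r $ p\<bar>" using f[of k] f[of e] by argo
  qed
  also have "\<dots> = 2 * n * \<bar>r $ f - r $ p\<bar>" by (simp add: n_def)
  finally have "norm r / (2 * n) \<le> \<bar>r $ f - r $ p\<bar>" using n by (simp add: field_simps)
  then have "norm r / (2 * n) * exp (y $ p - 1) / (1 + D)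
      \<le> \<bar>r $ f - r $ p\<bar> * exp (y $ p - 1) / (1 + D)"
    using D by (intro divide_right_mono mult_right_mono) auto
  also have "\<dots> \<le> hull_mass r y"
    using D q[of f] by (intro hull_mass_lower_bound) (auto simp: D_def)
  finally have mass: "norm r / (2 * n * exp 1) * exp (y $ p) / (1 + D) \<le> hull_mass r y"
    by (simp add: exp_diff)
  have "(\<Sum>k\<in>UNIV. y $ k) = y $ q + (\<Sum>k\<in>UNIV - {q}. y $ k)"
    by (simp add: sum.remove[of UNIV q])
  also have "(\<Sum>k\<in>UNIV - {q}. y $ k) \<le> (\<Sum>k\<in>UNIV - {q}. y $ p)"
    by (intro sum_mono p)
  also have "y $ q + (\<Sum>k\<in>UNIV - {q}. y $ p) = (\<Sum>k\<in>(UNIV::'n set). y $ p) - D"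
    by (simp only: sum.remove[of UNIV q] finite UNIV_I) (simp add: D_def)
  finally have "(\<Sum>k\<in>UNIV. y $ k) \<le> n * y $ p - D" by (simp add: n_def)
  then have "(\<Sum>k\<in>UNIV. y $ k) / n \<le> y $ p - D / n" using n by (simp add: field_simps)
  then show thesis using mass
    by (intro that[of q p] p q) (simp add: profile_def n_def[symmetric] D_def[symmetric])
qed

text \<open>The right-hand side is convex in \<open>u\<close>, and the left-hand side is its tangent at \<open>u = - ln a\<close>.\<close>

lemma exp_above_tangent:
  fixes a u :: real
  assumes "0 < a"
  shows "u + 1 + ln a \<le> a * exp u"
  using exp_ge_add_one_self[of "u + ln a"] assms by (simp add: exp_add mult.commute)

text \<open>For fixed \<open>D\<close> and \<open>N\<close>, maximizing over \<open>u\<close> leaves \<open>ln (1 + D) - D / n - 1 - ln N\<close>. Since the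
  logarithm grows more slowly than \<open>D / (2 n)\<close>, this bounds \<open>D\<close> and then \<open>N\<close>. With \<open>D\<close> bounded
  and \<open>N \<ge> d\<close>, the coefficient of \<open>exp u\<close> has a positive lower bound \<open>a\<close>, so the exponential
  outweighs \<open>u\<close> for large \<open>u\<close>; for very negative \<open>u\<close> the bound itself is below \<open>c\<close>.\<close>

lemma profile_bound_coercive:
  fixes n d c :: real
  assumes n: "0 < n" and d: "0 < d"
  obtains B where "\<And>u D N. 0 \<le> D \<Longrightarrow> d \<le> N \<Longrightarrow> c \<le> u - D / n - N * exp u / (1 + D) \<Longrightarrow>
    \<bar>u\<bar> \<le> B \<and> D \<le> B \<and> N \<le> B"
proof -
  define C where "C = 1 / (2 * n) + ln (2 * n) - 2"
  define B1 where "B1 = max 0 (2 * n * (C - c - ln d))"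
  define a where "a = d / (1 + B1)"
  define B3 where "B3 = (- 1 - ln (a / 2) - c) * (2 / a)"
  have B1: "0 \<le> B1" by (simp add: B1_def)
  then have a: "0 < a" using d by (simp add: a_def)
  show thesis
  proof (rule that[of "max (max \<bar>c\<bar> \<bar>B3\<bar>) (max B1 (exp (C - c)))"])
    fix u D N :: real
    assume D: "0 \<le> D" and N: "d \<le> N" and c: "c \<le> u - D / n - N * exp u / (1 + D)"
    have N0: "0 < N" using N d by simp
    have "u + 1 + ln (N / (1 + D)) \<le> N * exp u / (1 + D)"
      using exp_above_tangent[of "N / (1 + D)" u] N0 D by simp
    \<comment> \<open>The right-hand side of the hypothesis is replaced by its maximum over \<open>u\<close>.\<close>
    then have "c \<le> ln (1 + D) - D / n - 1 - ln N"
      using c N0 D by (simp add: ln_div)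
    \<comment> \<open>Half of the term \<open>D / n\<close> is spent on the logarithm and the other half bounds \<open>D\<close>.\<close>
    moreover have "ln (1 + D) \<le> (1 + D) / (2 * n) + ln (2 * n) - 1"
      using ln_le_minus_one[of "(1 + D) / (2 * n)"] n D by (simp add: ln_div)
    moreover have "(1 + D) / (2 * n) - D / n = 1 / (2 * n) - D / (2 * n)"
      using n by (simp add: field_simps)
    ultimately have key: "ln N + D / (2 * n) \<le> C - c" by (simp add: C_def)
    have "ln d \<le> ln N" using N d by simp
    then have "D / (2 * n) \<le> C - c - ln d" using key by simp
    then have "D \<le> 2 * n * (C - c - ln d)" using n by (simp add: field_simps)
    then have DB: "D \<le> B1" by (simp add: B1_def)
    have "0 \<le> D / (2 * n)" using D n by simp
    then have "ln N \<le> C - c" using key by simp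
    then have NB: "N \<le> exp (C - c)" using N0 by (metis exp_le_cancel_iff exp_ln)
    have Dn: "0 \<le> D / n" and "0 \<le> N * exp u / (1 + D)" using D n N0 by auto
    then have cu: "c \<le> u" using c by linarith
    have "a * exp u \<le> N * exp u / (1 + D)"
      using frac_le[of N d "1 + D" "1 + B1"] N d D DB mult_right_mono[of a "N / (1 + D)" "exp u"]
      by (simp add: a_def)
    then have "c \<le> u - a * exp u" using c Dn by linarith
    \<comment> \<open>The tangent for \<open>a / 2\<close> cancels \<open>u\<close> and leaves \<open>a / 2 * exp u\<close> bounded.\<close>
    moreover have "u + 1 + ln (a / 2) \<le> a / 2 * exp u" using a by (intro exp_above_tangent) simp
    ultimately have "a / 2 * exp u \<le> - 1 - ln (a / 2) - c" by (simp add: field_simps)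
    then have "exp u \<le> B3" using a by (simp add: B3_def field_simps)
    then have "u \<le> B3" using exp_ge_add_one_self[of u] by linarith
    with cu have "\<bar>u\<bar> \<le> max \<bar>c\<bar> \<bar>B3\<bar>" by linarith
    then show "\<bar>u\<bar> \<le> max (max \<bar>c\<bar> \<bar>B3\<bar>) (max B1 (exp (C - c))) \<and>
        D \<le> max (max \<bar>c\<bar> \<bar>B3\<bar>) (max B1 (exp (C - c))) \<and>
        N \<le> max (max \<bar>c\<bar> \<bar>B3\<bar>) (max B1 (exp (C - c)))"
      using DB NB by (auto simp: max.coboundedI1 max.coboundedI2)
  qed
qed

lemma profile_superlevel_bounded:
  fixes S :: "(real ^ 'n::finite) set"
  assumes d: "0 < d" and S: "\<And>r. r \<in> S \<Longrightarrow> r $ e = 0 \<and> d \<le> norm r"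
  obtains B where "\<And>r y. r \<in> S \<Longrightarrow> c \<le> profile r y \<Longrightarrow>
    norm r \<le> B \<and> norm y \<le> B \<and> profile r y \<le> B"
proof -
  define n where "n = real CARD('n)"
  define \<kappa> where "\<kappa> = 1 / (2 * n * exp 1)"
  have n: "n > 0" by (simp add: n_def)
  then have \<kappa>: "\<kappa> > 0" by (simp add: \<kappa>_def)
  obtain B where B: "\<And>u D N. 0 \<le> D \<Longrightarrow> \<kappa> * d \<le> N \<Longrightarrow>
      c \<le> u - D / n - N * exp u / (1 + D) \<Longrightarrow> \<bar>u\<bar> \<le> B \<and> D \<le> B \<and> N \<le> B"
    using profile_bound_coercive[of n "\<kappa> * d" c] n \<kappa> d by auto
  show thesis
  proof (rule that[of "max (B / \<kappa>) (max (n * (2 * B)) B)"])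
    fix r y :: "real ^ 'n"
    assume r: "r \<in> S" and c: "c \<le> profile r y"
    obtain p q where q: "\<And>k. y $ q \<le> y $ k" and p: "\<And>k. y $ k \<le> y $ p"
      and le: "profile r y \<le> y $ p - (y $ p - y $ q) / n
        - (norm r / (2 * n * exp 1)) * exp (y $ p) / (1 + (y $ p - y $ q))"
      using profile_upper_bound[of r e y] S[OF r] unfolding n_def by metis
    have D: "0 \<le> y $ p - y $ q" using p[of q] by simp
    have N: "\<kappa> * d \<le> \<kappa> * norm r" using S[OF r] \<kappa> by simp
    have le': "profile r y \<le> y $ p - (y $ p - y $ q) / n
        - \<kappa> * norm r * exp (y $ p) / (1 + (y $ p - y $ q))"
      using le by (simp add: \<kappa>_def)
    have b: "\<bar>y $ p\<bar> \<le> B" "y $ p - y $ q \<le> B" "\<kappa> * norm r \<le> B"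
      using B[OF D N order_trans[OF c le']] by auto
    have "0 \<le> (y $ p - y $ q) / n" "0 \<le> \<kappa> * norm r * exp (y $ p) / (1 + (y $ p - y $ q))"
      using D n \<kappa> by auto
    then have "profile r y \<le> B" using le' b by linarith
    moreover have "norm r \<le> B / \<kappa>" using b \<kappa> by (simp add: field_simps)
    moreover have "norm y \<le> n * (2 * B)"
    proof -
      have "norm y \<le> (\<Sum>k\<in>UNIV. \<bar>y $ k\<bar>)" by (rule norm_le_l1_cart)
      also have "\<dots> \<le> (\<Sum>k\<in>(UNIV::'n set). 2 * B)"
      proof (rule sum_mono)
        fix k show "\<bar>y $ k\<bar> \<le> 2 * B" using b p[of k] q[of k] by linarith
      qed
      finally show ?thesis by (simp add: n_def)
    qed
    ultimately show "norm r \<le> max (B / \<kappa>) (max (n * (2 * B)) B) \<and>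
        norm y \<le> max (B / \<kappa>) (max (n * (2 * B)) B) \<and>
        profile r y \<le> max (B / \<kappa>) (max (n * (2 * B)) B)" by linarith
  qed
qed

text \<open>A maximizing sequence is bounded, and along a convergent subsequence the means converge, so the
  masses converge as well and their limit is at least the mass of the limit.\<close>

lemma profile_attains_max:
  fixes S :: "(real ^ 'n::finite) set"
  assumes "closed S" "S \<noteq> {}" "0 \<notin> S" and S0: "\<And>r. r \<in> S \<Longrightarrow> r $ e = 0"
  obtains r' y' where "r' \<in> S" "\<And>r y. r \<in> S \<Longrightarrow> profile r y \<le> profile r' y'"
proof -
  obtain d where d: "0 < d" and dS: "\<And>r. r \<in> S \<Longrightarrow> d \<le> norm r"
    using separate_point_closed[OF assms(1,3)] by auto
  have Sd: "r $ e = 0 \<and> d \<le> norm r" if "r \<in> S" for r using S0 dS that by auto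
  define V where "V = {profile r y | r y. r \<in> S}"
  have Vne: "V \<noteq> {}" using assms(2) by (auto simp: V_def)
  obtain B0 where B0: "\<And>r y. r \<in> S \<Longrightarrow> 0 \<le> profile r y \<Longrightarrow> profile r y \<le> B0"
    using profile_superlevel_bounded[OF d Sd, where c = 0] by metis
  have "bdd_above V"
  proof (rule bdd_aboveI)
    fix v assume "v \<in> V"
    then obtain r y where "r \<in> S" "v = profile r y" by (auto simp: V_def)
    then show "v \<le> max 0 B0" using B0[of r y] by linarith
  qed
  then have le_Sup: "profile r y \<le> Sup V" if "r \<in> S" for r y
    using that by (intro cSup_upper) (auto simp: V_def)
  have "\<exists>r y. r \<in> S \<and> Sup V - 1 / real (Suc k) < profile r y" for k
    using less_cSupD[OF Vne, of "Sup V - 1 / real (Suc k)"] by (auto simp: V_def)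
  then obtain R Z where R: "\<And>k. R k \<in> S"
    and near: "\<And>k. Sup V - 1 / real (Suc k) < profile (R k) (Z k)"
    by metis
  obtain B where B: "\<And>r y. r \<in> S \<Longrightarrow> Sup V - 1 \<le> profile r y \<Longrightarrow> norm r \<le> B \<and> norm y \<le> B"
    using profile_superlevel_bounded[OF d Sd, where c = "Sup V - 1"] by metis
  have "Sup V - 1 \<le> profile (R k) (Z k)" for k
  proof -
    have "1 / real (Suc k) \<le> 1" by simp
    then show ?thesis using near[of k] by linarith
  qed
  then have bnd: "norm (R k) \<le> B \<and> norm (Z k) \<le> B" for k using B R by blast
  have "norm (R k, Z k) \<le> B + B" for k
    using norm_Pair_le[of "R k" "Z k"] bnd[of k] by linarith
  then have "bounded (range (\<lambda>k. (R k, Z k)))" by (auto simp: bounded_iff)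
  then obtain l f where f: "strict_mono f" and l: "((\<lambda>k. (R k, Z k)) \<circ> f) \<longlonglongrightarrow> l"
    using bounded_imp_convergent_subsequence by blast
  obtain r' y' where l': "l = (r', y')" by (cases l)
  have Rl: "(\<lambda>k. R (f k)) \<longlonglongrightarrow> r'" and Zl: "(\<lambda>k. Z (f k)) \<longlonglongrightarrow> y'"
    using tendsto_fst[OF l] tendsto_snd[OF l] by (simp_all add: o_def l')
  have r': "r' \<in> S" using closed_sequentially[OF assms(1) _ Rl] R by auto
  have prof: "(\<lambda>k. profile (R k) (Z k)) \<longlonglongrightarrow> Sup V"
  proof (rule tendsto_sandwich)
    show "(\<lambda>k. Sup V - 1 / real (Suc k)) \<longlonglongrightarrow> Sup V"
      using tendsto_diff[OF tendsto_const LIMSEQ_inverse_real_of_nat, of "Sup V"]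
      by (simp add: inverse_eq_divide)
    show "\<forall>\<^sub>F k in sequentially. Sup V - 1 / real (Suc k) \<le> profile (R k) (Z k)"
      using near by (simp add: less_imp_le)
  qed (use R le_Sup in auto)
  have proff: "(\<lambda>k. profile (R (f k)) (Z (f k))) \<longlonglongrightarrow> Sup V"
    using LIMSEQ_subseq_LIMSEQ[OF prof f] by (simp add: o_def)
  have mean: "(\<lambda>k. (\<Sum>i\<in>UNIV. Z (f k) $ i) / real CARD('n))
      \<longlonglongrightarrow> (\<Sum>i\<in>UNIV. y' $ i) / real CARD('n)"
    by (intro tendsto_intros Zl) auto
  have "(\<lambda>k. hull_mass (R (f k)) (Z (f k)))
      \<longlonglongrightarrow> (\<Sum>i\<in>UNIV. y' $ i) / real CARD('n) - Sup V"
    using tendsto_diff[OF mean proff] by (simp add: profile_def)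
  from hull_mass_limit_bound[OF Rl Zl this] have "Sup V \<le> profile r' y'"
    by (simp add: profile_def)
  then show thesis using that[of r' y'] r' le_Sup by (meson order_trans)
qed

section \<open>From the profile criterion back to the likelihood\<close>

lemma Lambda_hat_le_profile:
  fixes x :: "'n::finite \<Rightarrow> 'x" and Y :: "real ^ 'n"
  assumes "concave_ext \<phi>" and y: "\<And>i. \<phi> (Y $ i - m (x i)) = ereal (y $ i)"
  shows "Lambda_hat x Y \<phi> m \<le> ereal (profile (\<chi> i. Y $ i - m (x i)) y + 1)"
proof -
  define r where "r = (\<chi> i. Y $ i - m (x i))"
  have "ennreal (hull_mass r y) \<le> (\<integral>\<^sup>+ z. exp_ext (\<phi> z) \<partial>lborel)"
    unfolding ennreal_hull_mass
  proof (rule nn_integral_mono_AE)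
    show "AE z in lborel. exp_ext (upper_hull r y z) \<le> exp_ext (\<phi> z)"
      using AE_off_knots[of r]
    proof eventually_elim
      case (elim z)
      then show ?case
        by (intro exp_ext_mono upper_hull_minimal[OF assms(1)]) (auto simp: r_def y)
    qed
  qed
  then have "enn2ereal (ennreal (hull_mass r y)) \<le> enn2ereal (\<integral>\<^sup>+ z. exp_ext (\<phi> z) \<partial>lborel)"
    by (simp add: less_eq_ennreal.rep_eq)
  then have "ereal (hull_mass r y) \<le> enn2ereal (\<integral>\<^sup>+ z. exp_ext (\<phi> z) \<partial>lborel)"
    by (simp add: enn2ereal_ennreal hull_mass_nonneg)
  then have "ereal ((\<Sum>i\<in>UNIV. y $ i) / real CARD('n))
        - enn2ereal (\<integral>\<^sup>+ z. exp_ext (\<phi> z) \<partial>lborel) + 1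
      \<le> ereal ((\<Sum>i\<in>UNIV. y $ i) / real CARD('n)) - ereal (hull_mass r y) + 1"
    by (intro add_right_mono ereal_minus_mono) auto
  then show ?thesis by (simp add: Lambda_hat_def y profile_def r_def one_ereal_def)
qed

lemma profile_le_Lambda_hat:
  fixes x :: "'n::finite \<Rightarrow> 'x" and Y y :: "real ^ 'n"
  assumes r: "\<And>i. r $ i = Y $ i - m (x i)"
  shows "ereal (profile r y + 1) \<le> Lambda_hat x Y (upper_hull r y) m"
proof -
  have "ereal (\<Sum>i\<in>UNIV. y $ i) \<le> (\<Sum>i\<in>UNIV. upper_hull r y (Y $ i - m (x i)))"
    unfolding sum_ereal[symmetric] r[symmetric] by (intro sum_mono upper_hull_at_knot)
  from ereal_mult_left_mono[OF this, of "ereal (1 / real CARD('n))"]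
  have "ereal ((\<Sum>i\<in>UNIV. y $ i) / real CARD('n))
      \<le> ereal (1 / real CARD('n)) * (\<Sum>i\<in>UNIV. upper_hull r y (Y $ i - m (x i)))"
    by simp
  then have "ereal ((\<Sum>i\<in>UNIV. y $ i) / real CARD('n)) - ereal (hull_mass r y) + 1
      \<le> ereal (1 / real CARD('n)) * (\<Sum>i\<in>UNIV. upper_hull r y (Y $ i - m (x i)))
        - ereal (hull_mass r y) + 1"
    by (intro add_right_mono ereal_minus_mono) auto
  also have "\<dots> = Lambda_hat x Y (upper_hull r y) m"
    by (simp add: Lambda_hat_def ennreal_hull_mass[symmetric] hull_mass_nonneg)
  finally show ?thesis by (simp add: profile_def one_ereal_def)
qed

text \<open>This disposes of the \<open>\<phi>\<close> that are not finite at all residuals, to which the comparison with an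
  upper hull does not apply.\<close>

lemma Lambda_hat_eq_MInf:
  assumes "\<phi> \<in> Phi" "\<phi> (Y $ i - m (x i)) = -\<infinity>"
  shows "Lambda_hat x Y \<phi> m = -\<infinity>"
proof -
  define s where "s = (\<Sum>k\<in>UNIV - {i}. \<phi> (Y $ k - m (x k)))"
  have "s \<noteq> \<infinity>" using assms(1) by (auto simp: s_def sum_Pinfty Phi_def)
  then have "(\<Sum>k\<in>UNIV. \<phi> (Y $ k - m (x k))) = -\<infinity>"
    using assms(2) by (simp add: sum.remove[of UNIV i] s_def[symmetric])
  moreover have "-\<infinity> - enn2ereal J + 1 = -\<infinity>" for J
    by (cases "enn2ereal J") auto
  ultimately show ?thesis by (simp add: Lambda_hat_def)
qed

theorem theorem3p2:
  fixes x :: "'n::finite \<Rightarrow> 'x"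
    and M :: "('x \<Rightarrow> real) set"
    and Y :: "real ^ 'n"
  assumes "M \<noteq> {}"
    and "\<And>m c. m \<in> M \<Longrightarrow> (\<lambda>z. m z + c) \<in> M"
    and "closed (fitted_vectors x M)"
    and "Y \<notin> fitted_vectors x M"
  shows "\<exists>\<phi>hat \<in> Phi. \<exists>mhat \<in> M. \<forall>\<phi> \<in> Phi. \<forall>m \<in> M.
           Lambda_hat x Y \<phi> m \<le> Lambda_hat x Y \<phi>hat mhat"
proof -
  \<comment> \<open>Any index serves for the normalization \<open>r $ e = 0\<close>.\<close>
  define e :: 'n where "e = undefined"
  define res where "res m = (\<chi> i. Y $ i - m (x i))" for m
  define S where "S = {r \<in> res ` M. r $ e = 0}"
  define anchor where "anchor m = (\<lambda>z. m z + (Y $ e - m (x e)))" for m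
  have anchor: "anchor m \<in> M" if "m \<in> M" for m
    using assms(2)[OF that] by (simp add: anchor_def)
  have res_anchor: "res (anchor m) = (\<chi> i. res m $ i + - (Y $ e - m (x e)))" for m
    by (simp add: res_def anchor_def vec_eq_iff)
  have res_anchor_S: "res (anchor m) \<in> S" if "m \<in> M" for m
    using anchor[OF that] by (auto simp: S_def) (simp add: res_def anchor_def)
  have res_img: "res ` M = (\<lambda>v. Y - v) ` fitted_vectors x M"
  proof -
    have "fitted_vectors x M = (\<lambda>m. \<chi> i. m (x i)) ` M" by (auto simp: fitted_vectors_def)
    then show ?thesis
      by (simp add: image_image) (intro image_cong, auto simp: res_def vec_eq_iff)
  qed
  have "closed (res ` M)"
    unfolding res_img using closed_translation[OF closed_negations[OF assms(3)], of Y]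
    by (simp add: image_image)
  moreover have "closed {r :: real ^ 'n. r $ e = 0}"
    by (intro closed_Collect_eq continuous_intros)
  ultimately have "closed S"
    unfolding S_def by (simp add: Collect_conj_eq closed_Int)
  moreover have "S \<noteq> {}" using res_anchor_S assms(1) by auto
  moreover have "0 \<notin> S" using assms(4) by (auto simp: S_def res_img)
  moreover have "r $ e = 0" if "r \<in> S" for r using that by (simp add: S_def)
  ultimately obtain r' y' where r': "r' \<in> S"
    and max: "\<And>r y. r \<in> S \<Longrightarrow> profile r y \<le> profile r' y'"
    using profile_attains_max by metis
  obtain mhat where mhat: "mhat \<in> M" "r' = res mhat" using r' by (auto simp: S_def)
  have "Lambda_hat x Y \<phi> m \<le> Lambda_hat x Y (upper_hull r' y') mhat"
    if \<phi>: "\<phi> \<in> Phi" and m: "m \<in> M" for \<phi> m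
  proof (cases "\<exists>i. \<phi> (Y $ i - m (x i)) = -\<infinity>")
    case True
    then show ?thesis using Lambda_hat_eq_MInf[OF \<phi>] by fastforce
  next
    case False
    define y where "y = (\<chi> i. real_of_ereal (\<phi> (Y $ i - m (x i))))"
    have y: "\<phi> (Y $ i - m (x i)) = ereal (y $ i)" for i
      using False \<phi> by (auto simp: y_def Phi_def ereal_real)
    have "Lambda_hat x Y \<phi> m \<le> ereal (profile (res m) y + 1)"
      unfolding res_def using \<phi> y by (intro Lambda_hat_le_profile) (auto simp: Phi_def)
    also have "profile (res m) y = profile (res (anchor m)) y"
      unfolding res_anchor by (rule profile_shift[symmetric])
    also have "ereal (profile (res (anchor m)) y + 1) \<le> ereal (profile r' y' + 1)"
      using max[OF res_anchor_S[OF m]] by simp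
    also have "\<dots> \<le> Lambda_hat x Y (upper_hull r' y') mhat"
      by (rule profile_le_Lambda_hat) (simp add: mhat res_def)
    finally show ?thesis .
  qed
  then show ?thesis using upper_hull_in_Phi mhat(1) by blast
qed

end
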